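(* Let $F$ be a finite family of open subsets of a topological space $X$. Let $d>0$ be an integer such that $H_i(U)=0$ for every $i\ge d$ and every open subset $U$ of $X$. Suppose that $$H_{d-j}\left(\bigcap F'\right)=0$$ for every subfamily $F'\subset F$ of size $j$, $1\le j\le d+1$. Then $\bigcap F\neq\varnothing$. Furthermore, $\bigcap F$ is acyclic.
   Context: $H_*$ denotes reduced singular homology with coefficients in a fixed nonzero abelian group. Conventions: $H_{-1}(U)=0$ if and only if $U$ is nonempty; for the empty set, $H_q(\varnothing)=0$ for $q\ge 0$. A space $U$ is called acyclic if $H_q(U)=0$ for all $q\ge -1$. For a family $F'$ of sets, $\bigcap F'$ denotes the intersection of its members.
   Formalization: The family F is assumed to have at least d+1 members; without this the claim fails, e.g. for F = {∅}, d = 1, X the real line. *)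

theory Defs
  imports "HOL-Homology.Homology"
begin

text \<open>Reduced singular homology with coefficients in an abelian group, given as a type
  \<open>'g :: ab_group_add\<close>, defined as the homology of the augmented singular chain complex
  \[ \cdots \to C_1(Y;G) \to C_0(Y;G) \to C_{-1}(Y;G) = G \to 0. \]
  The simplices and their faces are those of \<^theory>\<open>HOL-Homology.Simplices\<close>; the homology
  groups of \<^theory>\<open>HOL-Homology.Homology_Groups\<close> have integer coefficients and vanish
  in degree -1 even for the empty space.\<close>

text \<open>The standard simplex of dimension -1 is empty, so there is exactly one singular simplex of
  dimension -1 in any space; as an extensional function it is \<open>\<lambda>_. undefined\<close>. Chains of
  degree -1 are the multiples of this simplex, i.e. a copy of the coefficient group.\<close>

definition aug_simplex_set :: "int \<Rightarrow> 'a topology \<Rightarrow> ((nat \<Rightarrow> real) \<Rightarrow> 'a) set" where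
  "aug_simplex_set q Y =
     (if 0 \<le> q then singular_simplex_set (nat q) Y
      else if q = -1 then {\<lambda>_. undefined} else {})"

definition aug_face :: "int \<Rightarrow> nat \<Rightarrow> ((nat \<Rightarrow> real) \<Rightarrow> 'a) \<Rightarrow> (nat \<Rightarrow> real) \<Rightarrow> 'a" where
  "aug_face q k \<sigma> = (if q = 0 then (\<lambda>_. undefined) else singular_face (nat q) k \<sigma>)"

text \<open>The map \<open>\<Sum> a\<^sub>\<sigma> \<sigma> \<mapsto> \<Sum> \<Sum> (-1)\<^sup>k a\<^sub>\<sigma> (\<partial>\<^sub>k \<sigma>)\<close> for \<open>q \<ge> 0\<close>; in degree 0 it is the
  augmentation.\<close>

definition aug_boundary ::
  "int \<Rightarrow> (((nat \<Rightarrow> real) \<Rightarrow> 'a) \<Rightarrow>\<^sub>0 'g::ab_group_add) \<Rightarrow> (((nat \<Rightarrow> real) \<Rightarrow> 'a) \<Rightarrow>\<^sub>0 'g)" where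
  "aug_boundary q c =
     (if q < 0 then 0
      else \<Sum>\<sigma>\<in>Poly_Mapping.keys c. \<Sum>k\<le>nat q.
             Poly_Mapping.single (aug_face q k \<sigma>)
               (if even k then Poly_Mapping.lookup c \<sigma> else - Poly_Mapping.lookup c \<sigma>))"

definition aug_chain_group ::
  "'g::ab_group_add itself \<Rightarrow> int \<Rightarrow> 'a topology \<Rightarrow> (((nat \<Rightarrow> real) \<Rightarrow> 'a) \<Rightarrow>\<^sub>0 'g) monoid" where
  "aug_chain_group G q Y =
     \<lparr>carrier = {c. Poly_Mapping.keys c \<subseteq> aug_simplex_set q Y}, monoid.mult = (+), one = 0\<rparr>"

definition aug_cycles ::
  "'g::ab_group_add itself \<Rightarrow> int \<Rightarrow> 'a topology \<Rightarrow> (((nat \<Rightarrow> real) \<Rightarrow> 'a) \<Rightarrow>\<^sub>0 'g) set" where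
  "aug_cycles G q Y = kernel (aug_chain_group G q Y) (aug_chain_group G (q - 1) Y) (aug_boundary q)"

definition aug_boundaries ::
  "'g::ab_group_add itself \<Rightarrow> int \<Rightarrow> 'a topology \<Rightarrow> (((nat \<Rightarrow> real) \<Rightarrow> 'a) \<Rightarrow>\<^sub>0 'g) set" where
  "aug_boundaries G q Y = aug_boundary (q + 1) ` carrier (aug_chain_group G (q + 1) Y)"

definition reduced_homology ::
  "'g::ab_group_add itself \<Rightarrow> int \<Rightarrow> 'a topology \<Rightarrow> (((nat \<Rightarrow> real) \<Rightarrow> 'a) \<Rightarrow>\<^sub>0 'g) set monoid" where
  "reduced_homology G q Y =
     ((aug_chain_group G q Y)\<lparr>carrier := aug_cycles G q Y\<rparr>) Mod aug_boundaries G q Y"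

definition acyclic_space :: "'g::ab_group_add itself \<Rightarrow> 'a topology \<Rightarrow> bool" where
  "acyclic_space G Y \<longleftrightarrow> (\<forall>q\<ge>-1. trivial_group (reduced_homology G q Y))"

text \<open>The augmented chains form a chain complex of abelian groups.\<close>

lemma aug_boundary_superset:
  assumes "finite A" "Poly_Mapping.keys c \<subseteq> A" "0 \<le> q"
  shows "aug_boundary q c =
    (\<Sum>\<sigma>\<in>A. \<Sum>k\<le>nat q. Poly_Mapping.single (aug_face q k \<sigma>)
       (if even k then Poly_Mapping.lookup c \<sigma> else - Poly_Mapping.lookup c \<sigma>))"
  unfolding aug_boundary_def using assms
  by (auto simp: in_keys_iff intro!: sum.mono_neutral_left sum.neutral)

lemma aug_boundary_0 [simp]: "aug_boundary q 0 = 0"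
  by (simp add: aug_boundary_def)

lemma aug_boundary_add: "aug_boundary q (a + b) = aug_boundary q a + aug_boundary q b"
proof (cases "q < 0")
  case False
  let ?A = "Poly_Mapping.keys a \<union> Poly_Mapping.keys b"
  have s: "Poly_Mapping.keys (a + b) \<subseteq> ?A"
    by (rule keys_add)
  have e: "Poly_Mapping.single f (if even k then x + y else - (x + y)) =
      Poly_Mapping.single f (if even k then x else - x) +
      Poly_Mapping.single f (if even k then y else - y)"
    for k :: nat and x y :: 'b and f :: "(nat \<Rightarrow> real) \<Rightarrow> 'a"
    by (simp flip: single_add)
  show ?thesis
    using False s
    by (simp only: aug_boundary_superset[of ?A] Poly_Mapping.lookup_add e sum.distrib
        finite_Un finite_keys Un_upper1 Un_upper2 not_less)
qed (simp add: aug_boundary_def)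

lemma aug_boundary_single:
  "0 \<le> q \<Longrightarrow> aug_boundary q (Poly_Mapping.single \<sigma> a) =
     (\<Sum>k\<le>nat q. Poly_Mapping.single (aug_face q k \<sigma>) (if even k then a else - a))"
  by (subst aug_boundary_superset[of "{\<sigma>}"])
    (auto simp: Poly_Mapping.lookup_single intro!: sum.cong)

lemma aug_boundary_sum: "aug_boundary q (\<Sum>i\<in>I. f i) = (\<Sum>i\<in>I. aug_boundary q (f i))"
  by (induction I rule: infinite_finite_induct) (auto simp: aug_boundary_add)

lemma poly_mapping_eq_sum_single:
  "c = (\<Sum>\<sigma>\<in>Poly_Mapping.keys c. Poly_Mapping.single \<sigma> (Poly_Mapping.lookup c \<sigma>))"
  by (rule poly_mapping_eqI) (auto simp: Poly_Mapping.lookup_sum Poly_Mapping.lookup_single when_def in_keys_iff)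

lemma aug_face_in:
  assumes "\<sigma> \<in> aug_simplex_set q Y" "0 \<le> q" "k \<le> nat q"
  shows "aug_face q k \<sigma> \<in> aug_simplex_set (q - 1) Y"
proof (cases "q = 0")
  case False
  then have "1 \<le> nat q" "nat (q - 1) = nat q - Suc 0"
    using assms by auto
  then show ?thesis
    using False assms singular_simplex_singular_face[of "nat q" Y \<sigma> k]
    by (auto simp: aug_simplex_set_def aug_face_def)
qed (auto simp: aug_simplex_set_def aug_face_def)

lemma aug_boundary_in:
  assumes "Poly_Mapping.keys c \<subseteq> aug_simplex_set q Y"
  shows "Poly_Mapping.keys (aug_boundary q c) \<subseteq> aug_simplex_set (q - 1) Y"
proof (cases "q < 0")
  case False
  have "Poly_Mapping.keys (Poly_Mapping.single (aug_face q k \<sigma>) b) \<subseteq> aug_simplex_set (q - 1) Y"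
    if "\<sigma> \<in> Poly_Mapping.keys c" "k \<in> {..nat q}" for \<sigma> k and b :: 'b
    using that aug_face_in[of \<sigma> q Y k] assms False by auto
  then show ?thesis
    using False unfolding aug_boundary_def
    by (simp only: if_False) (intro order_trans[OF keys_sum] UN_least; blast)
qed (simp add: aug_boundary_def)

lemma aug_face_face:
  assumes "i \<le> j" "j \<le> nat q - Suc 0" "1 \<le> q"
  shows "aug_face (q - 1) i (aug_face q (Suc j) \<sigma>) = aug_face (q - 1) j (aug_face q i \<sigma>)"
proof (cases "q = 1")
  case False
  define p where "p = nat q"
  have p: "2 \<le> p" "nat (q - 1) = p - Suc 0" and jp: "j \<le> p - Suc 0"
    using False assms by (auto simp: p_def)
  have "singular_face (p - Suc 0) i (singular_face p (Suc j) \<sigma>) t =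
        singular_face (p - Suc 0) j (singular_face p i \<sigma>) t" for t
  proof (cases "t \<in> standard_simplex (p - Suc 0 - Suc 0)")
    case True
    have fi: "simplical_face i t \<in> standard_simplex (p - Suc 0)"
      using True p assms(1) jp by (intro simplical_face_in_standard_simplex) auto
    have fj: "simplical_face j t \<in> standard_simplex (p - Suc 0)"
      using True p jp by (intro simplical_face_in_standard_simplex) auto
    have "simplical_face (Suc j) (simplical_face i t) = simplical_face i (simplical_face j t)"
      using assms(1) unfolding simplical_face_def by fastforce
    then show ?thesis
      using True by (simp add: singular_face_def fi fj)
  qed (simp add: singular_face_def)
  then show ?thesis
    using False assms p by (simp add: aug_face_def p_def fun_eq_iff)
qed (simp add: aug_face_def)

lemma aug_boundary_boundary: "aug_boundary (q - 1) (aug_boundary q c) = 0"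
proof (cases "q \<le> 0")
  case True
  then show ?thesis
    by (simp add: aug_boundary_def)
next
  case False
  then have q: "1 \<le> q" by simp
  define p where "p = nat q"
  have p: "1 \<le> p" "nat (q - 1) = p - Suc 0"
    using q by (auto simp: p_def)
  have single: "aug_boundary (q - 1) (aug_boundary q (Poly_Mapping.single \<sigma> a)) = 0"
    for \<sigma> :: "(nat \<Rightarrow> real) \<Rightarrow> 'a" and a :: 'b
  proof -
    define h where "h = (\<lambda>(x, i). Poly_Mapping.single (aug_face (q - 1) i (aug_face q x \<sigma>))
                           (if even (x + i) then a else - a))"
    define L where "L = {(x, i). x \<le> p \<and> i \<le> p - Suc 0 \<and> i < x}"
    define U where "U = {(x, i). x \<le> p \<and> i \<le> p - Suc 0 \<and> x \<le> i}"
    have sub: "L \<subseteq> {..p} \<times> {..p - Suc 0}" "U \<subseteq> {..p} \<times> {..p - Suc 0}"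
      by (auto simp: L_def U_def)
    have fin: "finite L" "finite U"
      using sub finite_subset by blast+
    have split: "{..p} \<times> {..p - Suc 0} = L \<union> U" "L \<inter> U = {}"
      by (auto simp: L_def U_def)
    have bij: "bij_betw (\<lambda>(i, j). (Suc j, i)) U L"
      using p by (intro bij_betwI[where g = "\<lambda>(x, i). (i, x - Suc 0)"]) (auto simp: L_def U_def)
    have "h (Suc j, i) = - h (i, j)" if "(i, j) \<in> U" for i j
      using that aug_face_face[of i j q \<sigma>] q
      by (auto simp: h_def U_def p_def single_uminus[symmetric] add.commute)
    then have "sum h L = (\<Sum>x\<in>U. - h x)"
      by (subst sum.reindex_bij_betw[OF bij, symmetric]) (auto intro!: sum.cong)
    then have "sum h ({..p} \<times> {..p - Suc 0}) = 0"
      using fin split by (simp add: sum.union_disjoint sum_negf)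
    moreover have "aug_boundary (q - 1) (aug_boundary q (Poly_Mapping.single \<sigma> a)) =
      (\<Sum>x\<le>p. \<Sum>i\<le>p - Suc 0. h (x, i))"
      using q p by (auto simp: aug_boundary_single aug_boundary_sum h_def p_def[symmetric] intro!: sum.cong)
    ultimately show ?thesis
      by (simp add: sum.cartesian_product)
  qed
  have "aug_boundary (q - 1) (aug_boundary q
      (\<Sum>\<sigma>\<in>Poly_Mapping.keys c. Poly_Mapping.single \<sigma> (Poly_Mapping.lookup c \<sigma>))) = 0"
    by (simp add: aug_boundary_sum single)
  then show ?thesis
    by (simp flip: poly_mapping_eq_sum_single)
qed

lemma comm_group_aug_chain_group: "comm_group (aug_chain_group G q Y)"
proof (rule comm_groupI)
  fix x assume x: "x \<in> carrier (aug_chain_group G q Y)"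
  show "\<exists>y\<in>carrier (aug_chain_group G q Y).
      y \<otimes>\<^bsub>aug_chain_group G q Y\<^esub> x = \<one>\<^bsub>aug_chain_group G q Y\<^esub>"
    by (rule bexI[of _ "- x"]) (use x in \<open>auto simp: aug_chain_group_def in_keys_iff subset_iff\<close>)
next
  fix x y
  assume "x \<in> carrier (aug_chain_group G q Y)" "y \<in> carrier (aug_chain_group G q Y)"
  then show "x \<otimes>\<^bsub>aug_chain_group G q Y\<^esub> y \<in> carrier (aug_chain_group G q Y)"
    using keys_add[of x y] by (auto simp: aug_chain_group_def)
qed (auto simp: aug_chain_group_def algebra_simps)

lemma aug_boundary_hom:
  "aug_boundary q \<in> hom (aug_chain_group G q Y) (aug_chain_group G (q - 1) Y)"
  using aug_boundary_in by (auto simp: hom_def aug_chain_group_def aug_boundary_add)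

lemma group_hom_aug_boundary:
  "group_hom (aug_chain_group G q Y) (aug_chain_group G (q - 1) Y) (aug_boundary q)"
  by (simp add: group_hom_def group_hom_axioms_def aug_boundary_hom comm_group.axioms(2)
      comm_group_aug_chain_group)

lemma comm_group_aug_cycles: "comm_group ((aug_chain_group G q Y)\<lparr>carrier := aug_cycles G q Y\<rparr>)"
proof -
  interpret C: comm_group "aug_chain_group G q Y"
    by (rule comm_group_aug_chain_group)
  have "subgroup (aug_cycles G q Y) (aug_chain_group G q Y)"
    unfolding aug_cycles_def by (rule group_hom.subgroup_kernel[OF group_hom_aug_boundary])
  then have "group ((aug_chain_group G q Y)\<lparr>carrier := aug_cycles G q Y\<rparr>)"
    by (rule C.subgroup_imp_group)
  then show ?thesis
    by (rule group.group_comm_groupI) (simp add: aug_chain_group_def add.commute)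
qed

lemma normal_aug_boundaries:
  fixes G :: "'g::ab_group_add itself" and Y :: "'a topology"
  shows "aug_boundaries G q Y \<lhd> (aug_chain_group G q Y)\<lparr>carrier := aug_cycles G q Y\<rparr>"
proof -
  interpret B: group_hom "aug_chain_group G (q + 1) Y" "aug_chain_group G q Y" "aug_boundary (q + 1)"
    using group_hom_aug_boundary[of G "q + 1" Y] by simp
  have "aug_boundary q (aug_boundary (q + 1) c) = 0" for c :: "((nat \<Rightarrow> real) \<Rightarrow> 'a) \<Rightarrow>\<^sub>0 'g"
    using aug_boundary_boundary[of "q + 1" c] by simp
  then have "aug_boundaries G q Y \<subseteq> aug_cycles G q Y"
    by (simp add: aug_boundary_in[where q = "q + 1" and Y = Y, simplified] aug_boundaries_def aug_cycles_def kernel_def aug_chain_group_def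
        image_subset_iff)
  moreover have "subgroup (aug_boundaries G q Y) (aug_chain_group G q Y)"
    unfolding aug_boundaries_def by (rule B.img_is_subgroup)
  moreover have "subgroup (aug_cycles G q Y) (aug_chain_group G q Y)"
    unfolding aug_cycles_def by (rule group_hom.subgroup_kernel[OF group_hom_aug_boundary])
  ultimately have "subgroup (aug_boundaries G q Y)
      ((aug_chain_group G q Y)\<lparr>carrier := aug_cycles G q Y\<rparr>)"
    by (intro group.subgroup_incl[OF B.H.is_group])
  then show ?thesis
    by (intro comm_group.subgroup_imp_normal[OF comm_group_aug_cycles])
qed

lemma trivial_reduced_homology_iff:
  "trivial_group (reduced_homology G q Y) \<longleftrightarrow> aug_cycles G q Y \<subseteq> aug_boundaries G q Y"
proof -
  let ?Z = "(aug_chain_group G q Y)\<lparr>carrier := aug_cycles G q Y\<rparr>"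
  interpret N: normal "aug_boundaries G q Y" ?Z
    by (rule normal_aug_boundaries)
  have sub: "aug_boundaries G q Y \<subseteq> aug_cycles G q Y"
    using N.subset by simp
  show ?thesis
  proof
    assume "trivial_group (reduced_homology G q Y)"
    then have *: "rcosets\<^bsub>?Z\<^esub> (aug_boundaries G q Y) = {aug_boundaries G q Y}"
      by (simp add: reduced_homology_def trivial_group_def FactGroup_def)
    show "aug_cycles G q Y \<subseteq> aug_boundaries G q Y"
    proof
      fix z assume "z \<in> aug_cycles G q Y"
      then have z: "z \<in> carrier ?Z" by simp
      then have "aug_boundaries G q Y #>\<^bsub>?Z\<^esub> z = aug_boundaries G q Y"
        using * N.subset by (metis N.rcosetsI singletonD)
      then show "z \<in> aug_boundaries G q Y"
        using N.rcos_self[OF z N.is_subgroup] by simp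
    qed
  next
    assume "aug_cycles G q Y \<subseteq> aug_boundaries G q Y"
    then have "aug_boundaries G q Y = carrier ?Z"
      using sub by auto
    then show "trivial_group (reduced_homology G q Y)"
    proof -
      assume eq: "aug_boundaries G q Y = carrier ?Z"
      have "rcosets\<^bsub>?Z\<^esub> (carrier ?Z) = {carrier ?Z}"
        using N.coset_join2 N.subgroup_self N.one_closed
        by (auto simp: RCOSETS_def simp del: partial_object.simps)
      then have "carrier (?Z Mod aug_boundaries G q Y) = {one (?Z Mod aug_boundaries G q Y)}"
        by (simp add: FactGroup_def eq)
      then show ?thesis
        unfolding reduced_homology_def trivial_group_def using N.factorgroup_is_group by blast
    qed
  qed
qed

lemma aug_simplex_set_empty:
  assumes "topspace Y = {}" "0 \<le> q"
  shows "aug_simplex_set q Y = {}"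
  using assms by (simp add: aug_simplex_set_def singular_simplex_empty[OF assms(1)] del: null_topspace_iff_trivial)

lemma trivial_reduced_homology_minus_one_iff:
  fixes G :: "'g::ab_group_add itself" and Y :: "'a topology"
  assumes "\<exists>g::'g. g \<noteq> 0"
  shows "trivial_group (reduced_homology G (-1) Y) \<longleftrightarrow> topspace Y \<noteq> {}"
proof -
  let ?u = "(\<lambda>_. undefined) :: (nat \<Rightarrow> real) \<Rightarrow> 'a"
  have Z: "aug_cycles G (-1) Y = {c. Poly_Mapping.keys c \<subseteq> {?u}}"
    by (auto simp: aug_cycles_def kernel_def aug_chain_group_def aug_simplex_set_def aug_boundary_def)
  show ?thesis
  proof (cases "topspace Y = {}")
    case True
    then have "aug_boundaries G (-1) Y = {0}"
      by (simp add: aug_boundaries_def aug_chain_group_def aug_simplex_set_empty)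
    moreover obtain g :: 'g where "g \<noteq> 0"
      using assms by blast
    then have "Poly_Mapping.single ?u g \<in> aug_cycles G (-1) Y" "Poly_Mapping.single ?u g \<noteq> 0"
      by (auto simp: Z simp flip: keys_eq_empty)
    ultimately show ?thesis
      using True by (auto simp: trivial_reduced_homology_iff)
  next
    case False
    then obtain y where y: "y \<in> topspace Y"
      by blast
    define s where "s = restrict (\<lambda>_. y) (standard_simplex 0)"
    have s: "singular_simplex 0 Y s"
      using y by (auto simp: s_def singular_simplex_def continuous_map_const
          intro: continuous_map_eq[of _ _ "\<lambda>_. y"])
    have "c \<in> aug_boundaries G (-1) Y" if "Poly_Mapping.keys c \<subseteq> {?u}" for c :: "((nat \<Rightarrow> real) \<Rightarrow> 'a) \<Rightarrow>\<^sub>0 'g"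
    proof -
      let ?b = "Poly_Mapping.single s (Poly_Mapping.lookup c ?u)"
      have "aug_boundary 0 ?b = Poly_Mapping.single ?u (Poly_Mapping.lookup c ?u)"
        by (simp add: aug_boundary_single aug_face_def)
      also have "\<dots> = c"
        using that by (intro poly_mapping_eqI)
          (auto simp: Poly_Mapping.lookup_single when_def in_keys_iff subset_iff)
      finally show ?thesis
        using s unfolding aug_boundaries_def aug_chain_group_def
        by (intro image_eqI[of _ _ ?b]) (auto simp: aug_simplex_set_def)
    qed
    then show ?thesis
      using False by (auto simp: trivial_reduced_homology_iff Z)
  qed
qed

lemma trivial_reduced_homology_empty:
  assumes "topspace Y = {}" "0 \<le> q"
  shows "trivial_group (reduced_homology G q Y)"
proof -
  have "aug_cycles G q Y \<subseteq> {0}"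
    using assms by (auto simp: aug_cycles_def kernel_def aug_chain_group_def aug_simplex_set_empty)
  moreover have "0 \<in> aug_boundaries G q Y"
    by (auto simp: aug_boundaries_def aug_chain_group_def image_iff intro!: exI[of _ 0])
  ultimately show ?thesis
    by (auto simp: trivial_reduced_homology_iff)
qed

end

(* The hypotheses are stable under replacing two members A, B of an indexed family by their union:
   for l further members with intersection C, the Mayer-Vietoris sequence of A Int C and B Int C
   yields H_{d-l-1}((A Un B) Int C) = 0 from the hypotheses for l + 1 and l + 2 members. By
   induction on the number n of members, H_q of the total intersection vanishes for all q >= d - n:
   the case q = d - n is a hypothesis, and for larger q one applies Mayer-Vietoris to the two
   intersections that omit B and A respectively; their union is the total intersection of the
   merged family. This gives acyclicity as soon as n >= d + 1.

   Mayer-Vietoris with coefficients in an abelian group comes from the integral barycentric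
   subdivision: subdivision and its chain homotopy to the identity are tensored with the group,
   and a relative cycle modulo small chains is moved into the small chains. *)
theory Submission
  imports Defs
begin

section \<open>Tensoring integral chains with the coefficient group\<close>

text \<open>The Z-module structure of an abelian group, taken as the integer power in the additive
  group viewed as a multiplicative structure, so that its laws are those of
  \<open>int_pow\<close>.\<close>

definition scale_int :: "int \<Rightarrow> 'g::ab_group_add \<Rightarrow> 'g" where
  "scale_int n g = g [^]\<^bsub>\<lparr>carrier = UNIV, monoid.mult = (+), one = 0\<rparr>\<^esub> n"

lemma comm_group_UNIV_add:
  "comm_group \<lparr>carrier = (UNIV :: 'g::ab_group_add set), monoid.mult = (+), one = 0\<rparr>"
  by (rule comm_groupI) (auto simp: algebra_simps intro: exI[of _ "- x" for x])

lemma scale_int_0 [simp]: "scale_int 0 g = 0"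
  by (simp add: scale_int_def)

lemma scale_int_1 [simp]: "scale_int 1 g = g"
  using group.int_pow_1[OF comm_group.axioms(2)[OF comm_group_UNIV_add], of g]
  by (simp add: scale_int_def)

lemma scale_int_add_left: "scale_int (m + n) g = scale_int m g + scale_int n g"
  using group.int_pow_mult[OF comm_group.axioms(2)[OF comm_group_UNIV_add], of g m n]
  by (simp add: scale_int_def)

lemma scale_int_diff_left: "scale_int (m - n) g = scale_int m g - scale_int n g"
  using scale_int_add_left[of "m - n" n g] by (simp add: algebra_simps)

lemma scale_int_add_right: "scale_int n (g + h) = scale_int n g + scale_int n h"
  using comm_group.int_pow_distrib[OF comm_group_UNIV_add, of g h n]
  by (simp add: scale_int_def)

lemma scale_int_zero_right [simp]: "scale_int n 0 = 0"
  using scale_int_add_right[of n 0 0] by simp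

text \<open>The elementary tensor of \<open>c\<close> and \<open>g\<close>, where Z[B] tensor G is
  identified with the finitely supported functions from B to G.\<close>

definition tensor :: "('b \<Rightarrow>\<^sub>0 int) \<Rightarrow> 'g::ab_group_add \<Rightarrow> ('b \<Rightarrow>\<^sub>0 'g)" where
  "tensor c g = Poly_Mapping.map (\<lambda>n. scale_int n g) c"

lemma lookup_tensor: "Poly_Mapping.lookup (tensor c g) x = scale_int (Poly_Mapping.lookup c x) g"
  by (simp add: tensor_def Poly_Mapping.map.rep_eq when_def)

lemma keys_tensor: "Poly_Mapping.keys (tensor c g) \<subseteq> Poly_Mapping.keys c"
  by (auto simp: in_keys_iff lookup_tensor)

lemma tensor_0 [simp]: "tensor 0 g = 0" "tensor c 0 = 0"
  by (auto intro!: poly_mapping_eqI simp: lookup_tensor)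

lemma tensor_diff: "tensor (a - b) g = tensor a g - tensor b g"
  by (rule poly_mapping_eqI) (simp add: lookup_tensor lookup_minus scale_int_diff_left)

lemma tensor_add_left: "tensor (a + b) g = tensor a g + tensor b g"
  by (rule poly_mapping_eqI) (simp add: lookup_tensor lookup_add scale_int_add_left)

lemma tensor_add_right: "tensor c (g + h) = tensor c g + tensor c h"
  by (rule poly_mapping_eqI) (simp add: lookup_tensor lookup_add scale_int_add_right)

lemma tensor_frag_of [simp]: "tensor (frag_of x) g = Poly_Mapping.single x g"
  by (rule poly_mapping_eqI) (simp add: lookup_tensor lookup_single when_def)

lemma tensor_sum_left: "tensor (\<Sum>i\<in>I. f i) g = (\<Sum>i\<in>I. tensor (f i) g)"
  by (induction I rule: infinite_finite_induct) (auto simp: tensor_add_left)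

text \<open>\<open>\<phi>\<close> gives the images of the basis elements; the result is the Z-linear
  extension of \<open>\<phi>\<close> tensored with the identity of the coefficient group.\<close>

definition tensor_extend ::
  "('b \<Rightarrow> ('c \<Rightarrow>\<^sub>0 int)) \<Rightarrow> ('b \<Rightarrow>\<^sub>0 'g::ab_group_add) \<Rightarrow> ('c \<Rightarrow>\<^sub>0 'g)" where
  "tensor_extend \<phi> c = (\<Sum>x\<in>Poly_Mapping.keys c. tensor (\<phi> x) (Poly_Mapping.lookup c x))"

lemma tensor_extend_superset:
  "finite A \<Longrightarrow> Poly_Mapping.keys c \<subseteq> A \<Longrightarrow>
     tensor_extend \<phi> c = (\<Sum>x\<in>A. tensor (\<phi> x) (Poly_Mapping.lookup c x))"
  unfolding tensor_extend_def by (rule sum.mono_neutral_left) (auto simp: in_keys_iff)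

lemma tensor_extend_0 [simp]: "tensor_extend \<phi> 0 = 0"
  by (simp add: tensor_extend_def)

lemma tensor_extend_single [simp]: "tensor_extend \<phi> (Poly_Mapping.single x g) = tensor (\<phi> x) g"
  by (subst tensor_extend_superset[of "{x}"]) auto

lemma tensor_extend_add: "tensor_extend \<phi> (a + b) = tensor_extend \<phi> a + tensor_extend \<phi> b"
proof -
  let ?A = "Poly_Mapping.keys a \<union> Poly_Mapping.keys b"
  have "Poly_Mapping.keys (a + b) \<subseteq> ?A"
    by (rule keys_add)
  then show ?thesis
    by (simp add: tensor_extend_superset[of ?A] lookup_add tensor_add_right sum.distrib)
qed

lemma tensor_extend_diff: "tensor_extend \<phi> (a - b) = tensor_extend \<phi> a - tensor_extend \<phi> b"
  using tensor_extend_add[of \<phi> "a - b" b] by (simp add: algebra_simps)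

lemma tensor_extend_sum: "tensor_extend \<phi> (\<Sum>i\<in>I. f i) = (\<Sum>i\<in>I. tensor_extend \<phi> (f i))"
  by (induction I rule: infinite_finite_induct) (auto simp: tensor_extend_add)

lemma keys_tensor_extend:
  "Poly_Mapping.keys (tensor_extend \<phi> c) \<subseteq> (\<Union>x\<in>Poly_Mapping.keys c. Poly_Mapping.keys (\<phi> x))"
  unfolding tensor_extend_def using keys_sum keys_tensor by fastforce

text \<open>An additive map is determined by its values on generators. Zero and differences suffice
  as assumptions because \<open>frag_induction\<close> builds chains from exactly these and
  generators.\<close>

lemma tensor_extend_tensor:
  assumes "\<Phi> 0 = 0" "\<And>a b. \<Phi> (a - b) = \<Phi> a - \<Phi> b"
  shows "tensor_extend (\<lambda>x. \<Phi> (frag_of x)) (tensor c g) = tensor (\<Phi> c) g"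
  using subset_refl[of "Poly_Mapping.keys c"]
  by (induction c rule: frag_induction)
    (simp_all add: assms tensor_diff tensor_extend_diff)

lemma aug_boundary_diff: "aug_boundary q (a - b) = aug_boundary q a - aug_boundary q b"
  using aug_boundary_add[of q "a - b" b] by (simp add: algebra_simps)

text \<open>This fails for \<open>p = 0\<close>, where \<^const>\<open>aug_boundary\<close> is the augmentation and
  \<^const>\<open>chain_boundary\<close> is zero.\<close>

lemma aug_boundary_tensor:
  assumes "0 < p"
  shows "aug_boundary (int p) (tensor c g) = tensor (chain_boundary p c) g"
  using subset_refl[of "Poly_Mapping.keys c"]
proof (induction c rule: frag_induction)
  case (one \<sigma>)
  have "tensor (frag_cmul ((-1) ^ k) (frag_of (singular_face p k \<sigma>))) g =
      Poly_Mapping.single (aug_face (int p) k \<sigma>) (if even k then g else - g)" for k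
  proof -
    have "tensor (- frag_of (singular_face p k \<sigma>)) g = - Poly_Mapping.single (singular_face p k \<sigma>) g"
      using tensor_diff[of 0 "frag_of (singular_face p k \<sigma>)" g] by simp
    then show ?thesis
      using assms by (simp add: aug_face_def single_uminus)
  qed
  then show ?case
    using assms by (simp add: aug_boundary_single chain_boundary_of tensor_sum_left)
qed (simp_all add: tensor_diff chain_boundary_diff aug_boundary_diff)

section \<open>Cycles and simplices of subspaces\<close>

lemma trivial_reduced_homology_iff_cycles_bound:
  "trivial_group (reduced_homology (G :: 'g::ab_group_add itself) q Y) \<longleftrightarrow>
     (\<forall>z :: _ \<Rightarrow>\<^sub>0 'g. Poly_Mapping.keys z \<subseteq> aug_simplex_set q Y \<and> aug_boundary q z = 0 \<longrightarrow>
        (\<exists>c. Poly_Mapping.keys c \<subseteq> aug_simplex_set (q + 1) Y \<and> aug_boundary (q + 1) c = z))"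
  unfolding trivial_reduced_homology_iff aug_cycles_def aug_boundaries_def kernel_def
    aug_chain_group_def by (auto simp: subset_iff image_iff)

text \<open>The guard \<open>0 \<le> q\<close> is there because the single simplex of degree -1
  belongs to every subspace, the empty one included.\<close>

lemma aug_simplex_set_subtopology:
  "\<sigma> \<in> aug_simplex_set q (subtopology X S) \<longleftrightarrow>
     \<sigma> \<in> aug_simplex_set q X \<and> (0 \<le> q \<longrightarrow> \<sigma> ` standard_simplex (nat q) \<subseteq> S)"
  by (simp add: aug_simplex_set_def singular_simplex_subtopology)

lemma aug_simplex_set_mono:
  "S \<subseteq> T \<Longrightarrow> aug_simplex_set q (subtopology X S) \<subseteq> aug_simplex_set q (subtopology X T)"
  by (auto simp: aug_simplex_set_subtopology subset_iff)

lemma aug_simplex_set_Int: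
  "aug_simplex_set q (subtopology X S) \<inter> aug_simplex_set q (subtopology X T) =
     aug_simplex_set q (subtopology X (S \<inter> T))"
  by (auto simp: aug_simplex_set_subtopology)

section \<open>Small chains by iterated barycentric subdivision\<close>

lemma poly_mapping_split_keys:
  assumes "Poly_Mapping.keys (c :: 'b \<Rightarrow>\<^sub>0 'g::ab_group_add) \<subseteq> A \<union> B"
  obtains a b where "c = a + b" "Poly_Mapping.keys a \<subseteq> A" "Poly_Mapping.keys b \<subseteq> B"
proof
  let ?a = "\<Sum>x\<in>Poly_Mapping.keys c \<inter> A. Poly_Mapping.single x (Poly_Mapping.lookup c x)"
  let ?b = "\<Sum>x\<in>Poly_Mapping.keys c - A. Poly_Mapping.single x (Poly_Mapping.lookup c x)"
  show "Poly_Mapping.keys ?a \<subseteq> A" "Poly_Mapping.keys ?b \<subseteq> B"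
    using assms by (intro order_trans[OF keys_sum] UN_least; auto)+
  have "c = (\<Sum>x\<in>Poly_Mapping.keys c. Poly_Mapping.single x (Poly_Mapping.lookup c x))"
    by (rule poly_mapping_eq_sum_single)
  also have "\<dots> = ?a + ?b"
    by (rule sum.Int_Diff) simp
  finally show "c = ?a + ?b" .
qed

text \<open>Subdivide \<open>w\<close> until every simplex lies in \<open>U\<close> or
  \<open>V\<close>. The homotopy from subdivision to the identity changes \<open>w\<close> by a
  boundary and by the image of \<open>aug_boundary q w\<close>; the latter is small because
  \<open>u\<close> and \<open>v\<close> are. Allowing a nonzero boundary \<open>u + v\<close> yields
  both exactness statements of Mayer-Vietoris used below.\<close>

lemma small_chains:
  fixes w :: "((nat \<Rightarrow> real) \<Rightarrow> 'a) \<Rightarrow>\<^sub>0 'g::ab_group_add"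
  assumes U: "openin X U" and V: "openin X V"
    and w: "Poly_Mapping.keys w \<subseteq> aug_simplex_set q (subtopology X (U \<union> V))"
    and dw: "aug_boundary q w = u + v"
    and u: "Poly_Mapping.keys u \<subseteq> aug_simplex_set (q - 1) (subtopology X U)"
    and v: "Poly_Mapping.keys v \<subseteq> aug_simplex_set (q - 1) (subtopology X V)"
  obtains a b t where "w = a + b + aug_boundary (q + 1) t"
    "Poly_Mapping.keys a \<subseteq> aug_simplex_set q (subtopology X U)"
    "Poly_Mapping.keys b \<subseteq> aug_simplex_set q (subtopology X V)"
    "Poly_Mapping.keys t \<subseteq> aug_simplex_set (q + 1) (subtopology X (U \<union> V))"
proof (cases "0 \<le> q")
  case False
  \<comment> \<open>In negative degree the simplices do not depend on the subspace, so
    \<open>w\<close> already is a chain of \<open>U\<close>.\<close>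
  then have "aug_simplex_set q (subtopology X (U \<union> V)) \<subseteq> aug_simplex_set q (subtopology X U)"
    by (auto simp: aug_simplex_set_subtopology)
  then show ?thesis
    using w by (intro that[of w 0 0]) auto
next
  case True
  define p where "p = nat q"
  have q: "q = int p"
    using True by (simp add: p_def)
  define Y where "Y = subtopology X (U \<union> V)"
  have w': "singular_simplex p Y \<sigma>" if "\<sigma> \<in> Poly_Mapping.keys w" for \<sigma>
    using that w by (auto simp: q aug_simplex_set_def Y_def)
  have opn: "openin Y W" if "W \<in> {U, V}" for W
    using that U V unfolding Y_def by (auto simp: openin_subtopology intro!: exI[of _ W])
  have cover: "topspace Y \<subseteq> \<Union>{U, V}"
    by (auto simp: Y_def)
  have "\<exists>n. \<forall>m f. n \<le> m \<longrightarrow> f \<in> Poly_Mapping.keys ((singular_subdivision p ^^ m) (frag_of \<sigma>)) \<longrightarrow>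
          (\<exists>W\<in>{U, V}. f \<in> standard_simplex p \<rightarrow> W)"
    if "\<sigma> \<in> Poly_Mapping.keys w" for \<sigma>
  proof -
    have chain: "singular_chain p Y (frag_of \<sigma>)"
      using w'[OF that] by (simp add: singular_chain_def)
    show ?thesis
      by (rule sufficient_iterated_singular_subdivision_exists[OF opn cover chain]) blast+
  qed
  then obtain N where N: "\<And>\<sigma> m f. \<sigma> \<in> Poly_Mapping.keys w \<Longrightarrow> N \<sigma> \<le> m \<Longrightarrow>
      f \<in> Poly_Mapping.keys ((singular_subdivision p ^^ m) (frag_of \<sigma>)) \<Longrightarrow>
      \<exists>W\<in>{U, V}. f \<in> standard_simplex p \<rightarrow> W"
    by metis
  \<comment> \<open>Smallness persists under further subdivision and \<open>w\<close> has finitely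
    many simplices, so one number serves all of them. For \<open>w = 0\<close> the maximum is
    unspecified, but any number will do.\<close>
  define n where "n = Max (N ` Poly_Mapping.keys w)"
  have n: "N \<sigma> \<le> n" if "\<sigma> \<in> Poly_Mapping.keys w" for \<sigma>
    using that by (simp add: n_def)
  \<comment> \<open>The same \<open>h\<close> preserves chains of every space, so the homotopy for
    \<open>U \<union> V\<close> also maps chains of \<open>U\<close> to chains of \<open>U\<close>,
    and likewise for \<open>V\<close>.\<close>
  obtain h where h: "\<And>p. h p 0 = (0 :: 'a chain)"
      "\<And>p c1 c2. h p (c1 - c2) = h p c1 - h p c2"
      "\<And>p X c. singular_chain p X c \<Longrightarrow> singular_chain (Suc p) X (h p c)"
      "\<And>p X c. singular_chain p X c \<Longrightarrow>
         chain_boundary (Suc p) (h p c) + h (p - Suc 0) (chain_boundary p c) =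
           (singular_subdivision p ^^ n) c - c"
    using chain_homotopic_iterated_singular_subdivision[of n] by blast
  define S where "S = tensor_extend (\<lambda>\<sigma>. (singular_subdivision p ^^ n) (frag_of \<sigma>)) w"
  define T where "T = (\<lambda>p. tensor_extend (\<lambda>\<sigma>. h p (frag_of \<sigma>)) ::
      (((nat \<Rightarrow> real) \<Rightarrow> 'a) \<Rightarrow>\<^sub>0 'g) \<Rightarrow> _)"
  have T_keys: "Poly_Mapping.keys (T r c) \<subseteq> aug_simplex_set (1 + int r) Z"
    if "Poly_Mapping.keys c \<subseteq> aug_simplex_set (int r) Z" for r c Z
  proof -
    have "Poly_Mapping.keys (h r (frag_of \<sigma>)) \<subseteq> aug_simplex_set (1 + int r) Z"
      if "\<sigma> \<in> aug_simplex_set (int r) Z" for \<sigma>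
      using h(3)[of r Z "frag_of \<sigma>"] that
      by (simp add: aug_simplex_set_def singular_chain_def nat_add_distrib)
    then show ?thesis
      using that unfolding T_def by (intro order_trans[OF keys_tensor_extend]) blast
  qed
  \<comment> \<open>In degree 0 the homotopy \<open>h\<close> satisfies \<open>\<partial> h = S - id\<close> without a term for the
    augmentation, because \<^const>\<open>chain_boundary\<close> vanishes in degree 0.\<close>
  define D where "D = (if p = 0 then 0 else T (p - 1) (aug_boundary q w))"
  have "aug_boundary (1 + q) (T p w) + D = S - w"
  proof -
    \<comment> \<open>All terms are additive in the chain, so the homotopy identity is checked on
      one simplex. It is a simplex of \<open>w\<close> because the identity for \<open>h\<close> is
      available on singular chains only.\<close>
    have single: "aug_boundary (1 + q) (T p (Poly_Mapping.single \<sigma> g)) +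
         (if p = 0 then 0 else T (p - 1) (aug_boundary q (Poly_Mapping.single \<sigma> g))) =
         tensor ((singular_subdivision p ^^ n) (frag_of \<sigma>)) g - Poly_Mapping.single \<sigma> g"
      if "\<sigma> \<in> Poly_Mapping.keys w" for \<sigma> g
    proof -
      have "singular_chain p Y (frag_of \<sigma>)"
        using w'[OF that] by (simp add: singular_chain_def)
      then have "tensor (chain_boundary (Suc p) (h p (frag_of \<sigma>)) +
            h (p - Suc 0) (chain_boundary p (frag_of \<sigma>))) g =
          tensor ((singular_subdivision p ^^ n) (frag_of \<sigma>) - frag_of \<sigma>) g"
        using h(4) by metis
      moreover have "aug_boundary (1 + q) (T p (Poly_Mapping.single \<sigma> g)) =
          tensor (chain_boundary (Suc p) (h p (frag_of \<sigma>))) g"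
        using aug_boundary_tensor[of "Suc p"] by (simp add: T_def q)
      moreover have "T (p - 1) (aug_boundary q (Poly_Mapping.single \<sigma> g)) =
          tensor (h (p - 1) (chain_boundary p (frag_of \<sigma>))) g" if "0 < p"
        using tensor_extend_tensor[of "h (p - 1)" "chain_boundary p (frag_of \<sigma>)" g] h(1,2)
          aug_boundary_tensor[OF that, of "frag_of \<sigma>" g] by (simp add: T_def q)
      moreover have "h (p - Suc 0) (chain_boundary p (frag_of \<sigma>)) = 0" if "p = 0"
        using that by (simp add: chain_boundary_def h(1))
      ultimately show ?thesis
        by (cases "p = 0") (simp_all add: tensor_add_left tensor_diff)
    qed
    let ?W = "\<lambda>\<sigma>. Poly_Mapping.single \<sigma> (Poly_Mapping.lookup w \<sigma>)"
    have T_sum: "T r (\<Sum>i\<in>I. f i) = (\<Sum>i\<in>I. T r (f i))" for r I and f :: "_ \<Rightarrow> _ \<Rightarrow>\<^sub>0 'g"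
      by (simp add: T_def tensor_extend_sum)
    have "aug_boundary (1 + q) (T p w) + D =
      aug_boundary (1 + q) (T p (\<Sum>\<sigma>\<in>Poly_Mapping.keys w. ?W \<sigma>)) +
        (if p = 0 then 0 else T (p - 1) (aug_boundary q (\<Sum>\<sigma>\<in>Poly_Mapping.keys w. ?W \<sigma>)))"
      by (simp add: D_def flip: poly_mapping_eq_sum_single)
    also have "\<dots> = (\<Sum>\<sigma>\<in>Poly_Mapping.keys w. aug_boundary (1 + q) (T p (?W \<sigma>)) +
         (if p = 0 then 0 else T (p - 1) (aug_boundary q (?W \<sigma>))))"
      by (simp add: aug_boundary_sum T_sum sum.distrib)
    also have "\<dots> = (\<Sum>\<sigma>\<in>Poly_Mapping.keys w.
        tensor ((singular_subdivision p ^^ n) (frag_of \<sigma>)) (Poly_Mapping.lookup w \<sigma>) - ?W \<sigma>)"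
      by (rule sum.cong[OF refl single])
    also have "\<dots> = S - w"
      by (simp add: S_def tensor_extend_def sum_subtractf flip: poly_mapping_eq_sum_single)
    finally show ?thesis .
  qed
  then have w_eq: "w = S - D - aug_boundary (q + 1) (T p w)"
    by (simp add: algebra_simps)
  let ?small = "aug_simplex_set q (subtopology X U) \<union> aug_simplex_set q (subtopology X V)"
  have "Poly_Mapping.keys S \<subseteq> ?small"
  proof -
    have "f \<in> ?small" if \<sigma>: "\<sigma> \<in> Poly_Mapping.keys w"
      and f: "f \<in> Poly_Mapping.keys ((singular_subdivision p ^^ n) (frag_of \<sigma>))" for f \<sigma>
    proof -
      have "singular_chain p Y ((singular_subdivision p ^^ m) (frag_of \<sigma>))" for m
        by (induction m) (use w'[OF \<sigma>] in
            \<open>auto simp: singular_chain_singular_subdivision singular_chain_def[of _ _ "frag_of \<sigma>"]\<close>)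
      then have "singular_simplex p Y f"
        using f unfolding singular_chain_def by blast
      then have "singular_simplex p X f"
        by (simp add: Y_def singular_simplex_subtopology)
      then show ?thesis
        using N[OF \<sigma> n[OF \<sigma>] f] by (auto simp: q aug_simplex_set_def singular_simplex_subtopology)
    qed
    then show ?thesis
      unfolding S_def using keys_tensor_extend by fastforce
  qed
  moreover have "Poly_Mapping.keys D \<subseteq> ?small"
  proof (cases "p = 0")
    case False
    then have "int (p - 1) = q - 1" "1 + int (p - 1) = q"
      by (auto simp: q)
    then have "Poly_Mapping.keys (T (p - 1) u) \<subseteq> aug_simplex_set q (subtopology X U)"
         "Poly_Mapping.keys (T (p - 1) v) \<subseteq> aug_simplex_set q (subtopology X V)"
      using T_keys[of u "p - 1"] T_keys[of v "p - 1"] u v by simp_all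
    \<comment> \<open>Here the splitting of the boundary of \<open>w\<close> enters: each summand of
      \<open>D\<close> stays in its own open set.\<close>
    moreover have "D = T (p - 1) u + T (p - 1) v"
      using False by (simp add: D_def dw T_def tensor_extend_add)
    ultimately show ?thesis
      using keys_add[of "T (p - 1) u" "T (p - 1) v"] by auto
  qed (simp add: D_def)
  ultimately have "Poly_Mapping.keys (S - D) \<subseteq> ?small"
    using keys_diff[of S D] by blast
  then obtain a b where "S - D = a + b"
    "Poly_Mapping.keys a \<subseteq> aug_simplex_set q (subtopology X U)"
    "Poly_Mapping.keys b \<subseteq> aug_simplex_set q (subtopology X V)"
    by (rule poly_mapping_split_keys)
  moreover have "- aug_boundary (q + 1) (T p w) = aug_boundary (q + 1) (- T p w)"
    using aug_boundary_diff[of "q + 1" 0 "T p w"] by simp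
  ultimately have "w = a + b + aug_boundary (q + 1) (- T p w)"
    using w_eq by (metis add_uminus_conv_diff)
  then show ?thesis
  proof (rule that)
    show "Poly_Mapping.keys (- T p w) \<subseteq> aug_simplex_set (q + 1) (subtopology X (U \<union> V))"
      using T_keys[of w p Y] w by (simp add: Y_def q add.commute)
  qed fact+
qed

section \<open>Two exactness statements of the Mayer-Vietoris sequence\<close>

text \<open>Exactness at H_q of the union. A cycle is homologous to \<open>a + b\<close> with
  \<open>a\<close> in \<open>U\<close> and \<open>b\<close> in \<open>V\<close>; the boundary of
  \<open>a\<close> represents its image under the connecting map. If it bounds \<open>s\<close> in
  the intersection, then \<open>a - s\<close> and \<open>b + s\<close> are cycles in
  \<open>U\<close> and \<open>V\<close>.\<close>

lemma mayer_vietoris_Un: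
  fixes G :: "'g::ab_group_add itself"
  assumes "openin X U" "openin X V"
    and hU: "trivial_group (reduced_homology G q (subtopology X U))"
    and hV: "trivial_group (reduced_homology G q (subtopology X V))"
    and hI: "trivial_group (reduced_homology G (q - 1) (subtopology X (U \<inter> V)))"
  shows "trivial_group (reduced_homology G q (subtopology X (U \<union> V)))"
  unfolding trivial_reduced_homology_iff_cycles_bound
proof (intro allI impI; elim conjE)
  let ?S = "\<lambda>q W. aug_simplex_set q (subtopology X W)"
  fix z :: "((nat \<Rightarrow> real) \<Rightarrow> 'a) \<Rightarrow>\<^sub>0 'g"
  assume z: "Poly_Mapping.keys z \<subseteq> ?S q (U \<union> V)" and "aug_boundary q z = 0"
  then have "aug_boundary q z = 0 + 0" "Poly_Mapping.keys 0 \<subseteq> ?S (q - 1) U"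
    "Poly_Mapping.keys 0 \<subseteq> ?S (q - 1) V"
    by simp_all
  then obtain a b t where eq: "z = a + b + aug_boundary (q + 1) t"
    and a: "Poly_Mapping.keys a \<subseteq> ?S q U" and b: "Poly_Mapping.keys b \<subseteq> ?S q V"
    and t: "Poly_Mapping.keys t \<subseteq> ?S (q + 1) (U \<union> V)"
    by (rule small_chains[OF assms(1,2) z])
  have dd: "aug_boundary q (aug_boundary (q + 1) c) = 0" for c :: "((nat \<Rightarrow> real) \<Rightarrow> 'a) \<Rightarrow>\<^sub>0 'g"
    using aug_boundary_boundary[of "q + 1" c] by simp
  then have ab: "aug_boundary q a + aug_boundary q b = 0"
    using \<open>aug_boundary q z = 0\<close> by (simp add: eq aug_boundary_add)
  then have ab': "aug_boundary q a = - aug_boundary q b"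
    by (simp add: eq_neg_iff_add_eq_0)
  then have "Poly_Mapping.keys (aug_boundary q a) = Poly_Mapping.keys (aug_boundary q b)"
    by simp
  \<comment> \<open>The boundaries of \<open>a\<close> and \<open>b\<close> agree up to sign, so
    their common support lies in both open sets.\<close>
  then have "Poly_Mapping.keys (aug_boundary q a) \<subseteq> ?S (q - 1) (U \<inter> V)"
    using aug_boundary_in[OF a] aug_boundary_in[OF b] aug_simplex_set_Int by blast
  moreover have "aug_boundary (q - 1) (aug_boundary q a) = 0"
    by (rule aug_boundary_boundary)
  ultimately obtain s where s: "Poly_Mapping.keys s \<subseteq> ?S q (U \<inter> V)"
    and ds: "aug_boundary q s = aug_boundary q a"
    using hI unfolding trivial_reduced_homology_iff_cycles_bound by fastforce
  have sUV: "Poly_Mapping.keys s \<subseteq> ?S q U" "Poly_Mapping.keys s \<subseteq> ?S q V"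
    using s aug_simplex_set_Int by blast+
  have "Poly_Mapping.keys (a - s) \<subseteq> ?S q U" "aug_boundary q (a - s) = 0"
    using keys_diff[of a s] a sUV(1) by (auto simp: aug_boundary_diff ds)
  then obtain u where u: "Poly_Mapping.keys u \<subseteq> ?S (q + 1) U" "aug_boundary (q + 1) u = a - s"
    using hU unfolding trivial_reduced_homology_iff_cycles_bound by blast
  have "Poly_Mapping.keys (b + s) \<subseteq> ?S q V" "aug_boundary q (b + s) = 0"
    using keys_add[of b s] b sUV(2) ab by (auto simp: aug_boundary_add ds add.commute)
  then obtain v where v: "Poly_Mapping.keys v \<subseteq> ?S (q + 1) V" "aug_boundary (q + 1) v = b + s"
    using hV unfolding trivial_reduced_homology_iff_cycles_bound by blast
  have "Poly_Mapping.keys (u + v + t) \<subseteq> ?S (q + 1) (U \<union> V)"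
    using keys_add[of "u + v" t] keys_add[of u v] u(1) v(1) t
      aug_simplex_set_mono[of U "U \<union> V" "q + 1" X] aug_simplex_set_mono[of V "U \<union> V" "q + 1" X]
    by blast
  moreover have "aug_boundary (q + 1) (u + v + t) = z"
    by (simp add: eq aug_boundary_add u v)
  ultimately show "\<exists>c. Poly_Mapping.keys c \<subseteq> ?S (q + 1) (U \<union> V) \<and> aug_boundary (q + 1) c = z"
    by blast
qed

text \<open>Exactness at H_q of the intersection. If \<open>z\<close> bounds \<open>u\<close> in
  \<open>U\<close> and \<open>v\<close> in \<open>V\<close>, then \<open>u - v\<close> is a cycle of
  the union. A filling of it, made small, corrects \<open>u\<close> to a chain of the intersection
  with the same boundary.\<close>

lemma mayer_vietoris_Int:
  fixes G :: "'g::ab_group_add itself"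
  assumes "openin X U" "openin X V"
    and hU: "trivial_group (reduced_homology G q (subtopology X U))"
    and hV: "trivial_group (reduced_homology G q (subtopology X V))"
    and hUn: "trivial_group (reduced_homology G (q + 1) (subtopology X (U \<union> V)))"
  shows "trivial_group (reduced_homology G q (subtopology X (U \<inter> V)))"
  unfolding trivial_reduced_homology_iff_cycles_bound
proof (intro allI impI; elim conjE)
  let ?S = "\<lambda>q W. aug_simplex_set q (subtopology X W)"
  fix z :: "((nat \<Rightarrow> real) \<Rightarrow> 'a) \<Rightarrow>\<^sub>0 'g"
  assume z: "Poly_Mapping.keys z \<subseteq> ?S q (U \<inter> V)" and dz: "aug_boundary q z = 0"
  then have zUV: "Poly_Mapping.keys z \<subseteq> ?S q U" "Poly_Mapping.keys z \<subseteq> ?S q V"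
    using aug_simplex_set_Int by blast+
  obtain u where u: "Poly_Mapping.keys u \<subseteq> ?S (q + 1) U" "aug_boundary (q + 1) u = z"
    using hU zUV(1) dz unfolding trivial_reduced_homology_iff_cycles_bound by blast
  obtain v where v: "Poly_Mapping.keys v \<subseteq> ?S (q + 1) V" "aug_boundary (q + 1) v = z"
    using hV zUV(2) dz unfolding trivial_reduced_homology_iff_cycles_bound by blast
  have "Poly_Mapping.keys (u - v) \<subseteq> ?S (q + 1) (U \<union> V)"
    using keys_diff[of u v] u(1) v(1)
      aug_simplex_set_mono[of U "U \<union> V" "q + 1" X] aug_simplex_set_mono[of V "U \<union> V" "q + 1" X]
    by blast
  moreover have "aug_boundary (q + 1) (u - v) = 0"
    by (simp add: aug_boundary_diff u v)
  ultimately obtain w where w: "Poly_Mapping.keys w \<subseteq> ?S (q + 1 + 1) (U \<union> V)"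
    and dw: "aug_boundary (q + 1 + 1) w = u - v"
    using hUn unfolding trivial_reduced_homology_iff_cycles_bound by blast
  \<comment> \<open>\<open>w\<close> is not a cycle, but its boundary is split between
    \<open>U\<close> and \<open>V\<close>, as \<open>small_chains\<close> requires.\<close>
  have "aug_boundary (q + 1 + 1) w = u + - v" "Poly_Mapping.keys u \<subseteq> ?S (q + 1 + 1 - 1) U"
    "Poly_Mapping.keys (- v) \<subseteq> ?S (q + 1 + 1 - 1) V"
    using u(1) v(1) dw by (auto simp: add.commute[of 1])
  then obtain a b t where eq: "w = a + b + aug_boundary (q + 1 + 1 + 1) t"
    and a: "Poly_Mapping.keys a \<subseteq> ?S (q + 1 + 1) U"
    and b: "Poly_Mapping.keys b \<subseteq> ?S (q + 1 + 1) V"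
    by (rule small_chains[OF assms(1,2) w])
  have dd: "aug_boundary r (aug_boundary (r + 1) c) = 0"
    for r and c :: "((nat \<Rightarrow> real) \<Rightarrow> 'a) \<Rightarrow>\<^sub>0 'g"
    using aug_boundary_boundary[of "r + 1" c] by simp
  let ?c = "u - aug_boundary (q + 1 + 1) a"
  \<comment> \<open>The two expressions for the corrected chain show that it lies in
    \<open>U\<close> and in \<open>V\<close>.\<close>
  have "?c = v + aug_boundary (q + 1 + 1) b"
    using dw dd[of "q + 1 + 1" t] by (simp add: eq aug_boundary_add algebra_simps)
  moreover have "Poly_Mapping.keys ?c \<subseteq> ?S (q + 1) U"
    using keys_diff[of u "aug_boundary (q + 1 + 1) a"] u(1) aug_boundary_in[OF a]
    by (auto simp: add.commute[of 1])
  moreover have "Poly_Mapping.keys (v + aug_boundary (q + 1 + 1) b) \<subseteq> ?S (q + 1) V"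
    using keys_add[of v "aug_boundary (q + 1 + 1) b"] v(1) aug_boundary_in[OF b]
    by (auto simp: add.commute[of 1])
  ultimately have "Poly_Mapping.keys ?c \<subseteq> ?S (q + 1) (U \<inter> V)"
    using aug_simplex_set_Int by (metis le_inf_iff)
  moreover have "aug_boundary (q + 1) ?c = z"
    using dd[of "q + 1" a] by (simp add: aug_boundary_diff u)
  ultimately show "\<exists>c. Poly_Mapping.keys c \<subseteq> ?S (q + 1) (U \<inter> V) \<and> aug_boundary (q + 1) c = z"
    by blast
qed

section \<open>Induction on the number of open sets\<close>

text \<open>There are no nonzero chains below degree -1. This extends the vanishing hypothesis to
  subfamilies with more than d + 1 members.\<close>

lemma trivial_reduced_homology_below:
  "q < -1 \<Longrightarrow> trivial_group (reduced_homology G q Y)"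
  by (auto simp: trivial_reduced_homology_iff_cycles_bound aug_simplex_set_def intro!: exI[of _ 0])

text \<open>The family is indexed because a merged member may coincide with another one, so that a
  set of sets would lose a member. The hypothesis ranges over all nonempty \<open>J\<close>, which
  makes it stable under merging. Of homology only the two Mayer-Vietoris implications and vanishing
  from degree \<open>d\<close> on are kept.\<close>

lemma topological_helly_indexed:
  fixes H :: "int \<Rightarrow> 'a set \<Rightarrow> bool" and A :: "'i \<Rightarrow> 'a set" and d :: int
  assumes Un: "\<And>q U V. openin X U \<Longrightarrow> openin X V \<Longrightarrow> H q U \<Longrightarrow> H q V \<Longrightarrow> H (q - 1) (U \<inter> V)
      \<Longrightarrow> H q (U \<union> V)"
    and Int: "\<And>q U V. openin X U \<Longrightarrow> openin X V \<Longrightarrow> H q U \<Longrightarrow> H q V \<Longrightarrow> H (q + 1) (U \<union> V)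
      \<Longrightarrow> H q (U \<inter> V)"
    and top: "\<And>q U. openin X U \<Longrightarrow> d \<le> q \<Longrightarrow> H q U"
    and "finite I" "I \<noteq> {}"
    and "\<And>i. i \<in> I \<Longrightarrow> openin X (A i)"
    and "\<And>J. J \<subseteq> I \<Longrightarrow> J \<noteq> {} \<Longrightarrow> H (d - int (card J)) (\<Inter>i\<in>J. A i)"
    and "d - int (card I) \<le> q"
  shows "H q (\<Inter>i\<in>I. A i)"
  using assms(4-)
proof (induction "card I" arbitrary: I A q rule: less_induct)
  case less
  note opn = less.prems(3) and hyp = less.prems(4)
  have opnI: "openin X (\<Inter>i\<in>J. A i)" if "J \<subseteq> I" "J \<noteq> {}" for J
    using that less.prems(1) opn finite_subset by (intro openin_INT2) auto
  consider "d \<le> q" | "q = d - int (card I)" | "q < d" "d - int (card I) < q"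
    using less.prems(5) by linarith
  then show ?case
  proof cases
    case 1
    then show ?thesis
      using top opnI less.prems(2) by blast
  next
    case 2
    then show ?thesis
      using hyp less.prems(2) by blast
  next
    case 3
    then have "1 < card I"
      by linarith
    then obtain a where a: "a \<in> I"
      by fastforce
    then have "card (I - {a}) \<noteq> 0"
      using \<open>1 < card I\<close> by simp
    then obtain b where b: "b \<in> I" "b \<noteq> a"
      by (metis Diff_iff card_eq_0_iff ex_in_conv singletonI)
    have card: "card (I - {x}) < card I" "int (card (I - {x})) = int (card I) - 1" if "x \<in> I" for x
      using that \<open>1 < card I\<close> less.prems(1) by (auto simp: card_Diff_singleton)
    \<comment> \<open>The induction hypothesis covers degrees from \<open>d - (card I - 1)\<close>
      on, and \<open>q\<close> is one of them since it exceeds \<open>d - card I\<close>.\<close>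
    have remove: "H q (\<Inter>i\<in>I - {x}. A i)" if "x \<in> I" "I - {x} \<noteq> {}" for x
      using less.prems(1) that(2) opn hyp card(2)[OF that(1)] 3
      by (intro less.hyps[OF card(1)[OF that(1)]]) auto
    \<comment> \<open>The merged family on \<open>I - {a}\<close>: the union of the two members
      takes the index \<open>b\<close>.\<close>
    define A' where "A' = A(b := A a \<union> A b)"
    have merge: "(\<Inter>i\<in>insert b K. A' i) = (\<Inter>i\<in>insert a K. A i) \<union> (\<Inter>i\<in>insert b K. A i)"
      if "a \<notin> K" "b \<notin> K" for K
      using that by (auto simp: A'_def)
    have "H (q + 1) (\<Inter>i\<in>I - {a}. A' i)"
    proof (rule less.hyps[OF card(1)[OF a]])
      show "openin X (A' i)" if "i \<in> I - {a}" for i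
        using that opn a b by (auto simp: A'_def intro: openin_Un)
      show "H (d - int (card J)) (\<Inter>i\<in>J. A' i)" if J: "J \<subseteq> I - {a}" "J \<noteq> {}" for J
      proof (cases "b \<in> J")
        case False
        then have "(\<Inter>i\<in>J. A' i) = (\<Inter>i\<in>J. A i)"
          by (auto simp: A'_def)
        then show ?thesis
          using hyp[of J] J by auto
      next
        case True
        define K where "K = J - {b}"
        have K: "J = insert b K" "a \<notin> K" "b \<notin> K" "finite K" "K \<subseteq> I"
          using True J less.prems(1) finite_subset[of J I] by (auto simp: K_def)
        have "H (d - int (card J)) (\<Inter>i\<in>insert a K. A i)"
          "H (d - int (card J)) (\<Inter>i\<in>insert b K. A i)"
          using hyp[of "insert a K"] hyp[of "insert b K"] K a b by auto
        \<comment> \<open>The intersection involves both \<open>a\<close> and \<open>b\<close>,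
          hence \<open>card J + 1\<close> members, and the hypothesis gives the degree one lower
          that \<open>Un\<close> needs.\<close>
        moreover have "H (d - int (card J) - 1) ((\<Inter>i\<in>insert a K. A i) \<inter> (\<Inter>i\<in>insert b K. A i))"
          using hyp[of "insert a (insert b K)"] K a b by (simp add: Int_ac algebra_simps)
        ultimately show ?thesis
          unfolding K(1) merge[OF K(2,3)] using K a b by (intro Un opnI) auto
      qed
    qed (use less.prems(1) a b card(2)[OF a] 3 in auto)
    \<comment> \<open>With the common part \<open>I - {a, b}\<close>, the total intersection of the
      merged family is the union of the two intersections omitting \<open>b\<close> and
      \<open>a\<close>.\<close>
    moreover have "I - {a} = insert b (I - {a, b})" "I - {b} = insert a (I - {a, b})"
      using a b by auto
    ultimately have "H (q + 1) ((\<Inter>i\<in>I - {b}. A i) \<union> (\<Inter>i\<in>I - {a}. A i))"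
      using merge[of "I - {a, b}"] by simp
    then have "H q ((\<Inter>i\<in>I - {b}. A i) \<inter> (\<Inter>i\<in>I - {a}. A i))"
      using a b by (intro Int opnI remove) auto
    moreover have "(\<Inter>i\<in>I - {b}. A i) \<inter> (\<Inter>i\<in>I - {a}. A i) = (\<Inter>i\<in>I. A i)"
      using b by blast
    ultimately show ?thesis
      by simp
  qed
qed

section \<open>Application to reduced homology\<close>

theorem mainTheorem1:
  fixes X :: "'a topology" and F :: "'a set set" and d :: nat
  assumes "\<exists>g::'g::ab_group_add. g \<noteq> 0"
    and "finite F"
    and "\<And>U. U \<in> F \<Longrightarrow> openin X U"
    and "d > 0"
    and "\<And>U i. openin X U \<Longrightarrow> int d \<le> i \<Longrightarrow>
           trivial_group (reduced_homology TYPE('g) i (subtopology X U))"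
    and "d + 1 \<le> card F"
    and "\<And>F' j. F' \<subseteq> F \<Longrightarrow> card F' = j \<Longrightarrow> 1 \<le> j \<Longrightarrow> j \<le> d + 1 \<Longrightarrow>
           trivial_group (reduced_homology TYPE('g) (int d - int j) (subtopology X (\<Inter>F')))"
  shows "\<Inter>F \<noteq> {} \<and> acyclic_space TYPE('g) (subtopology X (\<Inter>F))"
proof -
  let ?H = "\<lambda>q U. trivial_group (reduced_homology TYPE('g) q (subtopology X U))"
  have "?H q (\<Inter>U\<in>F. U)" if "-1 \<le> q" for q
  proof (rule topological_helly_indexed[where X = X and H = ?H and d = "int d"])
    show "?H (int d - int (card J)) (\<Inter>U\<in>J. U)" if "J \<subseteq> F" "J \<noteq> {}" for J
    \<comment> \<open>For larger \<open>J\<close> the degree \<open>d - card J\<close> is below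
      -1.\<close>
    proof (cases "card J \<le> d + 1")
      case True
      moreover have "card J \<noteq> 0"
        using that assms(2) by (metis card_0_eq finite_subset)
      ultimately show ?thesis
        using assms(7)[OF that(1) refl] by simp
    qed (simp add: trivial_reduced_homology_below)
    \<comment> \<open>At least \<open>d + 1\<close> members give \<open>d - card F \<le> -1\<close>,
      so the induction reaches every degree from -1 on.\<close>
    show "F \<noteq> {}" "int d - int (card F) \<le> q"
      using assms(6) that by auto
  qed (use assms(2,3,5) mayer_vietoris_Un mayer_vietoris_Int in auto)
  then have H: "?H q (\<Inter>F)" if "-1 \<le> q" for q
    using that by simp
  \<comment> \<open>Degree -1 detects nonemptiness, since the coefficient group is nonzero.\<close>
  then have "topspace (subtopology X (\<Inter>F)) \<noteq> {}"
    using trivial_reduced_homology_minus_one_iff[OF assms(1)] by blast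
  then show ?thesis
    using H by (auto simp: acyclic_space_def)
qed

end
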